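(* For every integer $n\ge 1$, $$ \overline{SOME}(n)=SOME(n)+DSOME(n)+\sum_{\substack{r\in\mathbb Z\\ r\ne 0}}(-1)^{r+1}\,\overline{SOME}\!\left(n-\frac{r(3r-1)}{2}\right)+\sum_{\substack{r\in\mathbb Z\\ r\ne 0}}(-1)^r\,SOME\bigl(n-r(3r-1)\bigr). $$
   Context: $SOME(n)$ is the sum of all odd parts in all partitions of $n$ minus the sum of all even parts in all partitions of $n$ (parts counted with multiplicity). $DSOME(n)$ is the sum of all odd parts minus the sum of all even parts, taken over all partitions of $n$ into distinct parts. An overpartition of $n$ is a partition of $n$ in which the first occurrence of each part size may be overlined; $\overline{SOME}(n)$ is the sum of all odd parts minus the sum of all even parts, taken over all overpartitions of $n$ (parts counted with multiplicity, overlined or not). Convention: $SOME(m)=\overline{SOME}(m)=0$ for every integer $m\le 0$, so both sums are finite. *)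

theory Defs
  imports "HOL-Analysis.Analysis" "HOL-Library.Multiset"
begin

definition partitions :: "nat \<Rightarrow> nat multiset set" where
  "partitions n = {P. 0 \<notin># P \<and> sum_mset P = n}"

definition distinct_partitions :: "nat \<Rightarrow> nat multiset set" where
  "distinct_partitions n = {P \<in> partitions n. \<forall>k. count P k \<le> 1}"

text \<open>
  An overpartition is a pair of the underlying partition \<open>P\<close> (overlined and non-overlined
  parts together) and the set \<open>A\<close> of those part sizes whose first occurrence is overlined.
\<close>
definition overpartitions :: "nat \<Rightarrow> (nat multiset \<times> nat set) set" where
  "overpartitions n = {(P, A). P \<in> partitions n \<and> A \<subseteq> set_mset P}"

definition odd_part_sum :: "nat multiset \<Rightarrow> int" where
  "odd_part_sum P = int (sum_mset (filter_mset odd P))"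

definition even_part_sum :: "nat multiset \<Rightarrow> int" where
  "even_part_sum P = int (sum_mset (filter_mset even P))"

text \<open>
  The argument is an integer because the recurrence evaluates these functions at negative
  numbers, where they vanish by convention. The bare name \<open>SOME\<close> is reserved for the
  choice operator.
\<close>
definition SOME_parts :: "int \<Rightarrow> int" where
  "SOME_parts m = (if m \<le> 0 then 0 else
     (\<Sum>P\<in>partitions (nat m). odd_part_sum P) - (\<Sum>P\<in>partitions (nat m). even_part_sum P))"

definition DSOME_parts :: "int \<Rightarrow> int" where
  "DSOME_parts m = (if m \<le> 0 then 0 else
     (\<Sum>P\<in>distinct_partitions (nat m). odd_part_sum P)
     - (\<Sum>P\<in>distinct_partitions (nat m). even_part_sum P))"

definition over_SOME_parts :: "int \<Rightarrow> int" where
  "over_SOME_parts m = (if m \<le> 0 then 0 else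
     (\<Sum>(P, A)\<in>overpartitions (nat m). odd_part_sum P)
     - (\<Sum>(P, A)\<in>overpartitions (nat m). even_part_sum P))"

text \<open>
  Sums over infinite sets and non-summable \<open>infsum\<close>s are 0 by default; the following facts
  show that these defaults are not used.
\<close>

lemma finite_partitions: "finite (partitions n)"
proof (rule finite_subset)
  have "size P \<le> sum_mset P" if "0 \<notin># P" for P :: "nat multiset"
    using that by (induction P) auto
  moreover have "k \<le> sum_mset P" if "k \<in># P" for k and P :: "nat multiset"
    using that by (simp add: sum_mset.remove)
  ultimately show "partitions n \<subseteq> (\<Union>s\<le>n. {P. set_mset P \<subseteq> {..n} \<and> size P = s})"
    by (fastforce simp: partitions_def)
  show "finite (\<Union>s\<le>n. {P. set_mset P \<subseteq> {..n} \<and> size P = s})"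
    by (simp flip: multisets_of_size_def add: finite_multisets_of_size)
qed

lemma finite_distinct_partitions: "finite (distinct_partitions n)"
  by (rule finite_subset[OF _ finite_partitions[of n]]) (auto simp: distinct_partitions_def)

lemma finite_overpartitions: "finite (overpartitions n)"
proof -
  have "overpartitions n = Sigma (partitions n) (\<lambda>P. Pow (set_mset P))"
    by (auto simp: overpartitions_def)
  then show ?thesis
    by (simp add: finite_partitions)
qed

lemma finite_pentagonal_support: "finite {r :: int. r * (3 * r - 1) div 2 < n}"
proof (rule finite_subset)
  have "r \<in> {-\<bar>n\<bar>..\<bar>n\<bar>}" if less: "r * (3 * r - 1) div 2 < n" for r :: int
  proof -
    have "even (r * (3 * r - 1))" by auto
    then have "r * (3 * r - 1) < 2 * n" using less by auto
    moreover have "2 * \<bar>r\<bar> \<le> r * (3 * r - 1)"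
    proof -
      have "\<bar>r\<bar> \<le> r * r"
        using mult_right_mono[of 1 "\<bar>r\<bar>" "\<bar>r\<bar>"] by (cases "r = 0") (auto simp: abs_mult_self_eq)
      then show ?thesis by (simp add: algebra_simps)
    qed
    ultimately show ?thesis by auto
  qed
  then show "{r. r * (3 * r - 1) div 2 < n} \<subseteq> {-\<bar>n\<bar>..\<bar>n\<bar>}" by blast
qed simp

lemma over_SOME_parts_summable:
  "(\<lambda>r. (-1) powi (r + 1) * real_of_int (over_SOME_parts (n - r * (3 * r - 1) div 2)))
     summable_on {r. r \<noteq> 0}"
proof -
  have "(\<lambda>r. (-1) powi (r + 1) * real_of_int (over_SOME_parts (n - r * (3 * r - 1) div 2)))
     summable_on {r. r * (3 * r - 1) div 2 < n} \<inter> {r. r \<noteq> 0}"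
    by (intro summable_on_finite finite_Int disjI1 finite_pentagonal_support)
  then show ?thesis
    by (rule summable_on_cong_neutral[THEN iffD1, rotated -1]) (auto simp: over_SOME_parts_def)
qed

lemma SOME_parts_summable:
  "(\<lambda>r. (-1) powi r * real_of_int (SOME_parts (n - r * (3 * r - 1)))) summable_on {r. r \<noteq> 0}"
proof -
  have "{r :: int. r * (3 * r - 1) < n} \<subseteq> {r. r * (3 * r - 1) div 2 < \<bar>n\<bar>} \<union> {0}"
  proof
    fix r :: int
    assume "r \<in> {r. r * (3 * r - 1) < n}"
    then show "r \<in> {r. r * (3 * r - 1) div 2 < \<bar>n\<bar>} \<union> {0}" by auto
  qed
  then have "finite {r :: int. r * (3 * r - 1) < n}"
    by (rule finite_subset) (simp add: finite_pentagonal_support)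
  then have "(\<lambda>r. (-1) powi r * real_of_int (SOME_parts (n - r * (3 * r - 1))))
     summable_on {r. r * (3 * r - 1) < n} \<inter> {r. r \<noteq> 0}"
    by (intro summable_on_finite finite_Int disjI1)
  then show ?thesis
    by (rule summable_on_cong_neutral[THEN iffD1, rotated -1]) (auto simp: SOME_parts_def)
qed

end

theory Submission
  imports Defs "HOL-Computational_Algebra.Formal_Power_Series"
begin

text \<open>
  Write \<open>S\<close>, \<open>D\<close>, \<open>O\<close> for the generating functions of \<open>SOME\<close>, \<open>DSOME\<close> and the overpartition
  analogue, and \<open>p\<close>, \<open>d\<close> for those counting partitions and distinct partitions.
  Splitting off one copy of every overlined part turns an overpartition into a partition
  together with a distinct partition, so \<open>O = S d + p D\<close>. Multiplying by Euler's product
  \<open>\<phi>(q) = (1 - q)(1 - q\<^sup>2)\<dots>\<close> and using \<open>p(q) \<phi>(q) = 1\<close> and \<open>d(q) \<phi>(q) = \<phi>(q\<^sup>2)\<close> gives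
  \<open>O(q) \<phi>(q) = S(q) \<phi>(q\<^sup>2) + D(q)\<close>; the pentagonal number theorem, applied in \<open>q\<close> and
  in \<open>q\<^sup>2\<close>, makes this the recurrence. All identities involving \<open>\<phi>\<close> are needed only modulo
  \<open>q\<^sup>n\<^sup>+\<^sup>1\<close>, where the finite sum of Shanks replaces the infinite product.
\<close>

unbundle no vec_syntax
unbundle fps_syntax

section \<open>Shanks' finite form of the pentagonal number theorem\<close>

definition euler_prod :: "nat \<Rightarrow> 'a::comm_ring_1 \<Rightarrow> 'a" where
  "euler_prod n q = (\<Prod>k\<in>{1..n}. 1 - q ^ k)"

text \<open>The generalized pentagonal numbers, as naturals so that they can be exponents. They are
  never negative, so \<open>nat\<close> truncates nothing.\<close>

definition pent :: "int \<Rightarrow> nat" where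
  "pent r = nat (r * (3 * r - 1) div 2)"

definition pent_sum :: "nat \<Rightarrow> 'a::comm_ring_1 \<Rightarrow> 'a" where
  "pent_sum n q = (\<Sum>r\<in>{- int n..int n}. (-1) ^ nat \<bar>r\<bar> * q ^ pent r)"

definition triang :: "nat \<Rightarrow> nat" where
  "triang n = n * (n + 1) div 2"

text \<open>The product over \<open>{s<..n}\<close> stands for \<open>euler_prod n q\<close> divided
  by \<open>euler_prod s q\<close>, written so that any commutative ring will do.\<close>

definition shanks_sum :: "nat \<Rightarrow> 'a::comm_ring_1 \<Rightarrow> 'a" where
  "shanks_sum n q = (\<Sum>s\<le>n. (-1) ^ s * q ^ (s * n + triang s) * (\<Prod>k\<in>{s<..n}. 1 - q ^ k))"

lemma triang_Suc: "triang (Suc n) = triang n + Suc n"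
proof -
  have "Suc n * (Suc n + 1) = n * (n + 1) + 2 * Suc n" by simp
  then show ?thesis unfolding triang_def by presburger
qed

lemma int_pent: "int (pent r) = r * (3 * r - 1) div 2"
proof -
  have "0 \<le> r * (3 * r - 1)"
    by (cases "r \<ge> 1") (auto intro: mult_nonneg_nonneg mult_nonpos_nonpos)
  then show ?thesis by (simp add: pent_def)
qed

lemma two_int_pent: "2 * int (pent r) = r * (3 * r - 1)"
proof -
  have "even (r * (3 * r - 1))" by auto
  then show ?thesis by (simp add: int_pent)
qed

lemma two_triang: "2 * triang n = n * (n + 1)"
  by (simp add: triang_def)

lemma pent_pos: "pent (int (Suc n)) = Suc n * Suc n + triang n"
proof -
  have "2 * int (pent (int (Suc n))) = 2 * int (Suc n * Suc n + triang n)"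
    unfolding two_int_pent using two_triang[of n, THEN arg_cong[where f = int]]
    by (simp add: algebra_simps)
  then show ?thesis by (simp only: mult_cancel_left of_nat_eq_iff) simp
qed

lemma pent_neg: "pent (- int n) = n * n + triang n"
proof -
  have "2 * int (pent (- int n)) = 2 * int (n * n + triang n)"
    unfolding two_int_pent using two_triang[of n, THEN arg_cong[where f = int]]
    by (simp add: algebra_simps)
  then show ?thesis by (simp only: mult_cancel_left of_nat_eq_iff) simp
qed

lemma pent_sum_Suc:
  "pent_sum (Suc n) q = pent_sum n q
     + (-1) ^ Suc n * (q ^ pent (int (Suc n)) + q ^ pent (- int (Suc n)))"
proof -
  have "{- int (Suc n)..int (Suc n)} =
      insert (int (Suc n)) (insert (- int (Suc n)) {- int n..int n})"
    by auto
  then show ?thesis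
    unfolding pent_sum_def by (simp add: algebra_simps nat_add_distrib)
qed

text \<open>The difference of consecutive sums telescopes already at the level of partial sums.\<close>

lemma shanks_partial:
  fixes q :: "'a::comm_ring_1"
  assumes "s \<le> n"
  shows "(\<Sum>i\<le>s. (-1) ^ i * q ^ (i * Suc n + triang i) * (\<Prod>k\<in>{i<..Suc n}. 1 - q ^ k))
       - (\<Sum>i\<le>s. (-1) ^ i * q ^ (i * n + triang i) * (\<Prod>k\<in>{i<..n}. 1 - q ^ k))
       = (-1) ^ Suc s * q ^ (Suc s * Suc n + triang s) * (\<Prod>k\<in>{s<..n}. 1 - q ^ k)"
  using assms
proof (induction s)
  case 0
  have "{0<..Suc n} = insert (Suc n) {0<..n}" by auto
  then show ?case by (simp add: triang_def algebra_simps)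
next
  case (Suc s)
  define R where "R = (\<Prod>k\<in>{Suc s<..n}. 1 - q ^ k)"
  have "{Suc s<..Suc n} = insert (Suc n) {Suc s<..n}" using Suc.prems by auto
  then have 1: "(\<Prod>k\<in>{Suc s<..Suc n}. 1 - q ^ k) = (1 - q ^ Suc n) * R"
    by (simp add: R_def)
  have "{s<..n} = insert (Suc s) {Suc s<..n}" using Suc.prems by auto
  then have 2: "(\<Prod>k\<in>{s<..n}. 1 - q ^ k) = (1 - q ^ Suc s) * R"
    by (simp add: R_def)
  \<comment> \<open>After factoring out \<open>(-1) ^ Suc s * Z * R\<close>, the induction step is
    \<open>(1 - q ^ Suc s) + q ^ Suc s * (1 - q ^ Suc n) - 1 = - (q ^ Suc s * q ^ Suc n)\<close>:
    old remainder, plus new term of the first sum, minus new term of the second.\<close>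
  define Z where "Z = q ^ (Suc s * n + triang (Suc s))"
  have e: "q ^ (Suc s * Suc n + triang s) = Z"
    "q ^ (Suc s * Suc n + triang (Suc s)) = Z * q ^ Suc s"
    "q ^ (Suc (Suc s) * Suc n + triang (Suc s)) = Z * q ^ Suc s * q ^ Suc n"
    unfolding Z_def triang_Suc power_add [symmetric] by (simp_all add: algebra_simps)
  have IH: "(\<Sum>i\<le>s. (-1) ^ i * q ^ (i * Suc n + triang i) * (\<Prod>k\<in>{i<..Suc n}. 1 - q ^ k))
       - (\<Sum>i\<le>s. (-1) ^ i * q ^ (i * n + triang i) * (\<Prod>k\<in>{i<..n}. 1 - q ^ k))
       = (-1) ^ Suc s * Z * ((1 - q ^ Suc s) * R)"
    using Suc unfolding 2 e by simp
  show ?case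
    unfolding sum.atMost_Suc 1 e R_def[symmetric] Z_def[symmetric]
    using IH by (simp add: algebra_simps del: power_Suc)
      (simp add: algebra_simps)
qed

text \<open>Both sides are 1 at \<open>n = 0\<close> and have equal increments: the extra summand
  \<open>s = Suc n\<close> carries the exponent \<open>pent (- int (Suc n))\<close>, and the
  remainder in \<open>shanks_partial\<close> at \<open>s = n\<close> carries
  \<open>pent (int (Suc n))\<close>.\<close>

lemma shanks_sum_eq_pent_sum: "shanks_sum n q = pent_sum n q"
proof (induction n)
  case 0
  show ?case by (simp add: shanks_sum_def pent_sum_def triang_def pent_def)
next
  case (Suc n)
  have "shanks_sum (Suc n) q - shanks_sum n q =
      (-1) ^ Suc n * q ^ (Suc n * Suc n + triang (Suc n))
      + (-1) ^ Suc n * q ^ (Suc n * Suc n + triang n)"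
    using shanks_partial[of n n q] by (simp add: shanks_sum_def)
  then show ?case
    unfolding pent_sum_Suc pent_pos pent_neg Suc.IH[symmetric] by (simp add: algebra_simps)
qed

text \<open>In \<open>shanks_sum\<close> the summand \<open>s = 0\<close> is the Euler product
  itself; every later one has exponent at least \<open>n + 1\<close>.\<close>

lemma power_dvd_pent_sum_diff_euler_prod:
  "q ^ Suc n dvd pent_sum n q - euler_prod n q"
proof -
  have "shanks_sum n q = euler_prod n q
      + (\<Sum>s<n. (-1) ^ Suc s * q ^ (Suc s * n + triang (Suc s)) * (\<Prod>k\<in>{Suc s<..n}. 1 - q ^ k))"
  proof -
    have "{0<..n} = {1..n}" by auto
    then show ?thesis
      unfolding shanks_sum_def euler_prod_def
      by (simp add: sum.atMost_shift triang_def del: power_Suc)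
  qed
  moreover have "q ^ Suc n dvd
      (-1) ^ Suc s * q ^ (Suc s * n + triang (Suc s)) * (\<Prod>k\<in>{Suc s<..n}. 1 - q ^ k)" for s
  proof -
    have "q ^ Suc n dvd q ^ (Suc s * n + triang (Suc s))"
      by (intro le_imp_power_dvd) (simp add: triang_Suc)
    then show ?thesis by (intro dvd_mult2 dvd_mult)
  qed
  ultimately show ?thesis
    by (simp add: shanks_sum_eq_pent_sum[symmetric] dvd_sum del: power_Suc)
qed

section \<open>Generating functions of partitions\<close>

text \<open>A bound on the parts gives finite products, accessible by induction on \<open>m\<close>;
  for \<open>n \<le> m\<close> the bound excludes nothing.\<close>

definition bounded_partitions :: "nat \<Rightarrow> nat \<Rightarrow> nat multiset set" where
  "bounded_partitions m n = {P \<in> partitions n. set_mset P \<subseteq> {..m}}"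

definition bounded_distinct_partitions :: "nat \<Rightarrow> nat \<Rightarrow> nat multiset set" where
  "bounded_distinct_partitions m n = {P \<in> distinct_partitions n. set_mset P \<subseteq> {..m}}"

lemma part_le_sum_mset: "k \<in># P \<Longrightarrow> k \<le> sum_mset (P :: nat multiset)"
  by (simp add: sum_mset.remove)

lemma bounded_partitions_eq: "n \<le> m \<Longrightarrow> bounded_partitions m n = partitions n"
  by (auto simp: bounded_partitions_def partitions_def dest: part_le_sum_mset)

lemma bounded_distinct_partitions_eq:
  "n \<le> m \<Longrightarrow> bounded_distinct_partitions m n = distinct_partitions n"
  by (auto simp: bounded_distinct_partitions_def distinct_partitions_def partitions_def
      dest: part_le_sum_mset)

lemma finite_bounded_partitions: "finite (bounded_partitions m n)"
  by (simp add: bounded_partitions_def finite_partitions)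

lemma finite_bounded_distinct_partitions: "finite (bounded_distinct_partitions m n)"
  by (simp add: bounded_distinct_partitions_def finite_distinct_partitions)

lemma bounded_partitions_0: "bounded_partitions 0 n = (if n = 0 then {{#}} else {})"
proof -
  have "P = {#}" if "P \<in> bounded_partitions 0 n" for P
    using that by (cases P) (auto simp: bounded_partitions_def partitions_def)
  moreover have "{#} \<in> bounded_partitions 0 n \<longleftrightarrow> n = 0"
    by (auto simp: bounded_partitions_def partitions_def)
  ultimately show ?thesis by auto
qed

lemma bounded_distinct_partitions_0:
  "bounded_distinct_partitions 0 n = (if n = 0 then {{#}} else {})"
proof -
  have "bounded_distinct_partitions 0 n = {P \<in> bounded_partitions 0 n. \<forall>k. count P k \<le> 1}"
    by (auto simp: bounded_distinct_partitions_def bounded_partitions_def distinct_partitions_def)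
  then show ?thesis by (auto simp: bounded_partitions_0)
qed

text \<open>Remove one copy of \<open>Suc m\<close> if there is one. Further copies may remain, so
  the bound in the second set stays \<open>Suc m\<close>.\<close>

lemma bounded_partitions_Suc:
  "bounded_partitions (Suc m) n = bounded_partitions m n \<union>
     (if Suc m \<le> n then add_mset (Suc m) ` bounded_partitions (Suc m) (n - Suc m) else {})"
  (is "?L = ?R")
proof (intro subset_antisym subsetI)
  fix P assume P: "P \<in> ?L"
  have le: "k \<le> m" if "k \<in># P" "k \<noteq> Suc m" for k
    using P that by (force simp: bounded_partitions_def)
  show "P \<in> ?R"
  proof (cases "Suc m \<in># P")
    case True
    then obtain Q where "P = add_mset (Suc m) Q" by (meson multi_member_split)
    with P show ?thesis by (auto simp: bounded_partitions_def partitions_def)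
  next
    case False
    then have "P \<in> bounded_partitions m n"
      using P le by (auto simp: bounded_partitions_def)
    then show ?thesis by simp
  qed
next
  fix P assume "P \<in> ?R"
  then show "P \<in> ?L"
    by (auto simp: bounded_partitions_def partitions_def split: if_splits)
qed

text \<open>Here removing \<open>Suc m\<close> leaves no further copy, so the bound drops to
  \<open>m\<close>.\<close>

lemma bounded_distinct_partitions_Suc:
  "bounded_distinct_partitions (Suc m) n = bounded_distinct_partitions m n \<union>
     (if Suc m \<le> n then add_mset (Suc m) ` bounded_distinct_partitions m (n - Suc m) else {})"
  (is "?L = ?R")
proof (intro subset_antisym subsetI)
  fix P assume P: "P \<in> ?L"
  have le: "k \<le> m" if "k \<in># P" "k \<noteq> Suc m" for k
    using P that by (force simp: bounded_distinct_partitions_def)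
  show "P \<in> ?R"
  proof (cases "Suc m \<in># P")
    case True
    then obtain Q where Q: "P = add_mset (Suc m) Q" by (meson multi_member_split)
    have c: "count P k \<le> 1" for k
      using P by (simp add: bounded_distinct_partitions_def distinct_partitions_def)
    have "Suc m \<notin># Q" using c[of "Suc m"] by (simp add: Q not_in_iff)
    moreover have "count Q k \<le> 1" for k
      using c[of k] by (simp add: Q split: if_splits)
    ultimately have "Q \<in> bounded_distinct_partitions m (n - Suc m)" "Suc m \<le> n"
      using P le
      by (auto simp: Q bounded_distinct_partitions_def distinct_partitions_def partitions_def)
    then show ?thesis using Q by simp
  next
    case False
    then have "P \<in> bounded_distinct_partitions m n"
      using P le by (auto simp: bounded_distinct_partitions_def)
    then show ?thesis by simp
  qed
next
  fix P assume P: "P \<in> ?R"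
  show "P \<in> ?L"
  proof (cases "P \<in> bounded_distinct_partitions m n")
    case True
    then show ?thesis by (auto simp: bounded_distinct_partitions_def)
  next
    case False
    with P obtain Q where Q: "P = add_mset (Suc m) Q" "Suc m \<le> n"
      "Q \<in> bounded_distinct_partitions m (n - Suc m)"
      by (auto split: if_splits)
    then have "Suc m \<notin># Q" by (auto simp: bounded_distinct_partitions_def)
    then have "count P k \<le> 1" for k
      using Q
      by (cases "k = Suc m")
        (simp_all add: bounded_distinct_partitions_def distinct_partitions_def not_in_iff)
    then show ?thesis
      using Q by (auto simp: bounded_distinct_partitions_def distinct_partitions_def partitions_def)
  qed
qed

lemma card_bounded_partitions_Suc:
  "card (bounded_partitions (Suc m) n) = card (bounded_partitions m n) +
     (if Suc m \<le> n then card (bounded_partitions (Suc m) (n - Suc m)) else 0)"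
proof (cases "Suc m \<le> n")
  case True
  have "card (bounded_partitions m n \<union> add_mset (Suc m) ` bounded_partitions (Suc m) (n - Suc m))
      = card (bounded_partitions m n)
        + card (add_mset (Suc m) ` bounded_partitions (Suc m) (n - Suc m))"
    by (rule card_Un_disjoint)
      (auto simp: finite_bounded_partitions, auto simp: bounded_partitions_def)
  then show ?thesis
    using True by (subst bounded_partitions_Suc) (simp add: card_image inj_on_def)
qed (simp add: bounded_partitions_Suc[of m n])

lemma card_bounded_distinct_partitions_Suc:
  "card (bounded_distinct_partitions (Suc m) n) = card (bounded_distinct_partitions m n) +
     (if Suc m \<le> n then card (bounded_distinct_partitions m (n - Suc m)) else 0)"
proof (cases "Suc m \<le> n")
  case True
  have "card (bounded_distinct_partitions m n
          \<union> add_mset (Suc m) ` bounded_distinct_partitions m (n - Suc m))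
      = card (bounded_distinct_partitions m n)
        + card (add_mset (Suc m) ` bounded_distinct_partitions m (n - Suc m))"
    by (rule card_Un_disjoint)
      (auto simp: finite_bounded_distinct_partitions, auto simp: bounded_distinct_partitions_def)
  then show ?thesis
    using True by (subst bounded_distinct_partitions_Suc) (simp add: card_image inj_on_def)
qed (simp add: bounded_distinct_partitions_Suc[of m n])

text \<open>By the cardinality recursion, multiplying by \<open>1 - fps_X ^ Suc m\<close> lowers the
  bound by one, so the factors of \<open>euler_prod\<close> are absorbed one by one.\<close>

lemma bounded_partitions_fps:
  "Abs_fps (\<lambda>n. int (card (bounded_partitions m n))) * euler_prod m fps_X = 1"
proof (induction m)
  case 0
  show ?case by (rule fps_ext) (simp add: bounded_partitions_0 euler_prod_def)
next
  case (Suc m)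
  have "Abs_fps (\<lambda>n. int (card (bounded_partitions (Suc m) n))) * (1 - fps_X ^ Suc m)
      = Abs_fps (\<lambda>n. int (card (bounded_partitions m n)))"
    by (rule fps_ext)
      (auto simp: ring_distribs fps_X_power_mult_right_nth card_bounded_partitions_Suc[of m]
        simp del: power_Suc)
  moreover have "euler_prod (Suc m) fps_X = (1 - fps_X ^ Suc m) * euler_prod m (fps_X :: int fps)"
    by (simp add: euler_prod_def mult.commute del: power_Suc)
  ultimately show ?case using Suc.IH by (simp add: mult.assoc[symmetric])
qed

lemma bounded_distinct_partitions_fps:
  "Abs_fps (\<lambda>n. int (card (bounded_distinct_partitions m n))) = (\<Prod>k\<in>{1..m}. 1 + fps_X ^ k)"
proof (induction m)
  case 0
  show ?case by (rule fps_ext) (simp add: bounded_distinct_partitions_0)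
next
  case (Suc m)
  have "Abs_fps (\<lambda>n. int (card (bounded_distinct_partitions (Suc m) n)))
      = Abs_fps (\<lambda>n. int (card (bounded_distinct_partitions m n))) * (1 + fps_X ^ Suc m)"
    by (rule fps_ext)
      (auto simp: ring_distribs fps_X_power_mult_right_nth card_bounded_distinct_partitions_Suc[of m]
        simp del: power_Suc)
  then show ?case using Suc.IH by (simp del: power_Suc)
qed

section \<open>Congruences modulo powers of \<open>fps_X\<close>\<close>

lemma fps_X_power_dvd_iff_nth:
  fixes f :: "'a::comm_ring_1 fps"
  shows "fps_X ^ k dvd f \<longleftrightarrow> (\<forall>i<k. f $ i = 0)"
proof
  assume "\<forall>i<k. f $ i = 0"
  then have "f = fps_X ^ k * fps_shift k f"
    by (intro fps_ext) (simp add: fps_X_power_mult_nth)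
  then show "fps_X ^ k dvd f" by (rule dvdI)
qed (auto elim!: dvdE simp: fps_X_power_mult_nth)

definition partition_fps :: "int fps" where
  "partition_fps = Abs_fps (\<lambda>n. int (card (partitions n)))"

definition distinct_partition_fps :: "int fps" where
  "distinct_partition_fps = Abs_fps (\<lambda>n. int (card (distinct_partitions n)))"

lemma partition_fps_times_pent_sum:
  "fps_X ^ Suc n dvd partition_fps * pent_sum n fps_X - 1"
proof -
  define P where "P = Abs_fps (\<lambda>k. int (card (bounded_partitions n k)))"
  have "fps_X ^ Suc n dvd partition_fps - P"
    by (simp add: fps_X_power_dvd_iff_nth P_def partition_fps_def bounded_partitions_eq
        del: power_Suc)
  \<comment> \<open>The two mixed terms \<open>P * pent_sum n fps_X\<close> cancel, leaving the
    difference of \<open>partition_fps * pent_sum n fps_X\<close> and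
    \<open>P * euler_prod n fps_X\<close>.\<close>
  then have "fps_X ^ Suc n dvd (partition_fps - P) * pent_sum n fps_X
      + P * (pent_sum n fps_X - euler_prod n fps_X)"
    by (intro dvd_add dvd_mult2 dvd_mult[OF power_dvd_pent_sum_diff_euler_prod])
  moreover have "P * euler_prod n fps_X = 1"
    unfolding P_def by (rule bounded_partitions_fps)
  ultimately show ?thesis by (simp add: algebra_simps del: power_Suc)
qed

text \<open>The source is \<open>(1 + q ^ k) * (1 - q ^ k) = 1 - (q ^ 2) ^ k\<close>, taken over all
  \<open>k \<le> n\<close>.\<close>

lemma distinct_partition_fps_times_pent_sum:
  "fps_X ^ Suc n dvd distinct_partition_fps * pent_sum n fps_X - pent_sum n (fps_X ^ 2)"
proof -
  define D where "D = (\<Prod>k\<in>{1..n}. 1 + (fps_X :: int fps) ^ k)"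
  let ?X = "fps_X :: int fps"
  have "fps_X ^ Suc n dvd distinct_partition_fps - D"
    unfolding D_def bounded_distinct_partitions_fps[symmetric]
    by (simp add: fps_X_power_dvd_iff_nth distinct_partition_fps_def bounded_distinct_partitions_eq
        del: power_Suc)
  \<comment> \<open>In \<open>?X ^ 2\<close> the congruence even holds modulo
    \<open>?X ^ (2 * Suc n)\<close>.\<close>
  moreover have "?X ^ Suc n dvd pent_sum n (?X ^ 2) - euler_prod n (?X ^ 2)"
    by (rule dvd_trans[OF _ power_dvd_pent_sum_diff_euler_prod])
      (simp add: power_mult[symmetric] le_imp_power_dvd del: power_Suc)
  ultimately have "?X ^ Suc n dvd (distinct_partition_fps - D) * pent_sum n ?X
      + D * (pent_sum n ?X - euler_prod n ?X) - (pent_sum n (?X ^ 2) - euler_prod n (?X ^ 2))"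
    by (auto intro!: dvd_diff[OF dvd_add]
      intro: dvd_mult2 dvd_mult[OF power_dvd_pent_sum_diff_euler_prod]
      simp del: power_Suc)
  moreover have "D * euler_prod n ?X = euler_prod n (?X ^ 2)"
    unfolding D_def euler_prod_def prod.distrib[symmetric]
    by (intro prod.cong) (simp_all add: algebra_simps power_mult[symmetric] power_add[symmetric] mult_2)
  ultimately show ?thesis by (simp add: algebra_simps del: power_Suc)
qed

section \<open>Overpartitions\<close>

definition alt_sum :: "nat multiset \<Rightarrow> int" where
  "alt_sum P = odd_part_sum P - even_part_sum P"

lemma alt_sum_empty: "alt_sum {#} = 0"
  by (simp add: alt_sum_def odd_part_sum_def even_part_sum_def)

lemma alt_sum_union: "alt_sum (P + Q) = alt_sum P + alt_sum Q"
  by (simp add: alt_sum_def odd_part_sum_def even_part_sum_def)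

lemma partitions_0: "partitions 0 = {{#}}"
  using bounded_partitions_0[of 0] bounded_partitions_eq[of 0 0] by simp

text \<open>At \<open>n = 0\<close> the conventional value 0 agrees with the sum, since the empty
  partition has weight 0.\<close>

lemma SOME_parts_int: "SOME_parts (int n) = (\<Sum>P\<in>partitions n. alt_sum P)"
  by (simp add: SOME_parts_def alt_sum_def sum_subtractf partitions_0
      odd_part_sum_def even_part_sum_def)

lemma DSOME_parts_int: "DSOME_parts (int n) = (\<Sum>P\<in>distinct_partitions n. alt_sum P)"
proof (cases "n = 0")
  case True
  have "(\<Sum>P\<in>distinct_partitions 0. alt_sum P) = 0"
    by (rule sum.neutral) (auto simp: distinct_partitions_def partitions_0 alt_sum_empty)
  then show ?thesis
    using True by (simp add: DSOME_parts_def)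
qed (simp add: DSOME_parts_def alt_sum_def sum_subtractf)

lemma over_SOME_parts_int:
  "over_SOME_parts (int n) = (\<Sum>(P, A)\<in>overpartitions n. alt_sum P)"
proof (cases "n = 0")
  case True
  have "(\<Sum>(P, A)\<in>overpartitions 0. alt_sum P) = 0"
    by (rule sum.neutral) (auto simp: overpartitions_def partitions_0 alt_sum_empty)
  then show ?thesis
    using True by (simp add: over_SOME_parts_def)
qed (simp add: over_SOME_parts_def alt_sum_def sum_subtractf case_prod_unfold)

lemma bij_betw_overpartitions:
  "bij_betw (\<lambda>(Q, R). (Q + R, set_mset R))
     (\<Union>i\<le>n. partitions i \<times> distinct_partitions (n - i)) (overpartitions n)"
proof (rule bij_betw_byWitness[where f' = "\<lambda>(P, A). (P - mset_set A, mset_set A)"])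
  \<comment> \<open>With multiplicities at most 1, \<open>R\<close> is recovered from its support;
    hence the overlined sizes encode a distinct partition.\<close>
  have mset_set: "mset_set (set_mset R) = R" if "R \<in> distinct_partitions k" for R k
  proof (rule multiset_eqI)
    fix x
    have "count R x = 0 \<or> count R x = 1"
      using that by (auto simp: distinct_partitions_def le_Suc_eq)
    moreover have "x \<in># R \<longleftrightarrow> count R x \<noteq> 0" by (simp add: not_in_iff)
    ultimately show "count (mset_set (set_mset R)) x = count R x"
      by (auto simp only: count_mset_set' finite_set_mset split: if_splits)
  qed
  then show "\<forall>a\<in>\<Union>i\<le>n. partitions i \<times> distinct_partitions (n - i).
      (\<lambda>(P, A). (P - mset_set A, mset_set A)) ((\<lambda>(Q, R). (Q + R, set_mset R)) a) = a"
    by auto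
  \<comment> \<open>This makes the truncated multiset difference \<open>P - mset_set A\<close>
    exact.\<close>
  have sub: "mset_set A \<subseteq># P" "finite A" if "A \<subseteq> set_mset P" for A and P :: "nat multiset"
    using that finite_subset[OF that]
    by (auto simp: subseteq_mset_def count_mset_set')
  show "\<forall>a'\<in>overpartitions n.
      (\<lambda>(Q, R). (Q + R, set_mset R)) ((\<lambda>(P, A). (P - mset_set A, mset_set A)) a') = a'"
    by (auto simp: overpartitions_def sub)
  show "(\<lambda>(Q, R). (Q + R, set_mset R)) ` (\<Union>i\<le>n. partitions i \<times> distinct_partitions (n - i))
      \<subseteq> overpartitions n"
    by (auto simp: overpartitions_def distinct_partitions_def partitions_def)
  show "(\<lambda>(P, A). (P - mset_set A, mset_set A)) ` overpartitions n
      \<subseteq> (\<Union>i\<le>n. partitions i \<times> distinct_partitions (n - i))"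
  proof (rule image_subsetI)
    fix x assume "x \<in> overpartitions n"
    then obtain P A where x: "x = (P, A)" and P: "P \<in> partitions n" and A: "A \<subseteq> set_mset P"
      by (auto simp: overpartitions_def)
    define Q where "Q = P - mset_set A"
    have eq: "P = Q + mset_set A" using sub[OF A] by (simp add: Q_def)
    have "sum_mset Q \<le> n" "Q \<in> partitions (sum_mset Q)"
      "mset_set A \<in> distinct_partitions (n - sum_mset Q)"
      using P by (auto simp: eq partitions_def distinct_partitions_def count_mset_set')
    then show "(\<lambda>(P, A). (P - mset_set A, mset_set A)) x
        \<in> (\<Union>i\<le>n. partitions i \<times> distinct_partitions (n - i))"
      unfolding x by (auto simp flip: Q_def)
  qed
qed

section \<open>The generating function of the overpartition sums\<close>

definition SOME_fps :: "int fps" where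
  "SOME_fps = Abs_fps (\<lambda>n. SOME_parts (int n))"

definition DSOME_fps :: "int fps" where
  "DSOME_fps = Abs_fps (\<lambda>n. DSOME_parts (int n))"

definition over_SOME_fps :: "int fps" where
  "over_SOME_fps = Abs_fps (\<lambda>n. over_SOME_parts (int n))"

text \<open>The weight is additive over the pair \<open>(Q, R)\<close>: \<open>alt_sum Q\<close> is
  counted once for each \<open>R\<close> and \<open>alt_sum R\<close> once for each
  \<open>Q\<close>, which gives two Cauchy products.\<close>

lemma over_SOME_fps_eq:
  "over_SOME_fps = SOME_fps * distinct_partition_fps + partition_fps * DSOME_fps"
proof (rule fps_ext)
  fix n
  have "over_SOME_fps $ n = (\<Sum>(P, A)\<in>overpartitions n. alt_sum P)"
    by (simp add: over_SOME_fps_def over_SOME_parts_int)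
  also have "\<dots> = (\<Sum>(Q, R)\<in>(\<Union>i\<le>n. partitions i \<times> distinct_partitions (n - i)).
      alt_sum Q + alt_sum R)"
    by (subst sum.reindex_bij_betw[OF bij_betw_overpartitions, symmetric])
      (simp add: case_prod_unfold alt_sum_union)
  also have "\<dots> = (\<Sum>i\<le>n. \<Sum>(Q, R)\<in>partitions i \<times> distinct_partitions (n - i).
      alt_sum Q + alt_sum R)"
    \<comment> \<open>Disjointness holds because \<open>i\<close> is the sum of
      \<open>Q\<close>.\<close>
    by (rule sum.UNION_disjoint)
      (auto simp: finite_partitions finite_distinct_partitions, auto simp: partitions_def)
  also have "\<dots> = (\<Sum>i\<le>n. \<Sum>Q\<in>partitions i. \<Sum>R\<in>distinct_partitions (n - i).
      alt_sum Q + alt_sum R)"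
    by (simp add: sum.cartesian_product)
  also have "\<dots> = (\<Sum>i\<le>n. SOME_parts (int i) * int (card (distinct_partitions (n - i)))
      + int (card (partitions i)) * DSOME_parts (int (n - i)))"
    by (intro sum.cong refl)
      (simp add: sum.distrib SOME_parts_int DSOME_parts_int sum_distrib_left
          sum_distrib_right mult.commute del: of_nat_diff)
  also have "\<dots> = (SOME_fps * distinct_partition_fps + partition_fps * DSOME_fps) $ n"
    by (simp add: fps_mult_nth sum.distrib atLeast0AtMost SOME_fps_def DSOME_fps_def
        partition_fps_def distinct_partition_fps_def)
  finally show "over_SOME_fps $ n =
      (SOME_fps * distinct_partition_fps + partition_fps * DSOME_fps) $ n" .
qed

lemma over_SOME_fps_times_pent_sum:
  "fps_X ^ Suc n dvd over_SOME_fps * pent_sum n fps_X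
     - (SOME_fps * pent_sum n (fps_X ^ 2) + DSOME_fps)"
proof -
  have "fps_X ^ Suc n dvd
      SOME_fps * (distinct_partition_fps * pent_sum n fps_X - pent_sum n (fps_X ^ 2))
      + DSOME_fps * (partition_fps * pent_sum n fps_X - 1)"
    by (intro dvd_add dvd_mult distinct_partition_fps_times_pent_sum partition_fps_times_pent_sum)
  then show ?thesis by (simp add: over_SOME_fps_eq algebra_simps del: power_Suc)
qed

section \<open>Coefficient extraction and truncation of the sums over \<open>r\<close>\<close>

lemma fps_mult_pent_sum_nth:
  fixes g :: "int \<Rightarrow> int"
  assumes "\<And>m. m < 0 \<Longrightarrow> g m = 0"
  shows "(Abs_fps (\<lambda>k. g (int k)) * pent_sum m (fps_X ^ c)) $ n =
    (\<Sum>r\<in>{- int m..int m}. (-1) ^ nat \<bar>r\<bar> * g (int n - int (c * pent r)))"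
proof -
  have "(Abs_fps (\<lambda>k. g (int k)) * ((-1) ^ j * (fps_X ^ c) ^ e)) $ n
      = (-1) ^ j * g (int n - int (c * e))" for j e
  proof -
    have "Abs_fps (\<lambda>k. g (int k)) * ((-1) ^ j * (fps_X ^ c) ^ e) =
        fps_const ((-1) ^ j) * (fps_X ^ (c * e) * Abs_fps (\<lambda>k. g (int k)))"
      by (simp add: power_mult algebra_simps flip: fps_const_power fps_const_neg)
    also have "\<dots> $ n = (-1) ^ j * g (int n - int (c * e))"
      \<comment> \<open>If \<open>c * e > n\<close>, the shifted series has coefficient 0, which is
        the value of \<open>g\<close> at a negative argument.\<close>
      unfolding fps_mult_left_const_nth fps_X_power_mult_nth
      using assms[of "int n - int (c * e)"] by (auto simp: of_nat_diff simp flip: of_nat_mult)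
    finally show ?thesis .
  qed
  then show ?thesis
    unfolding pent_sum_def sum_distrib_left fps_sum_nth by simp
qed

text \<open>From \<open>3 * r * r - r \<ge> 3 * \<bar>r\<bar> - \<bar>r\<bar>\<close>. It confines
  the nonzero terms of the recurrence to \<open>\<bar>r\<bar> \<le> n\<close>.\<close>

lemma abs_le_pent: "\<bar>r\<bar> \<le> int (pent r)"
proof -
  have "\<bar>r\<bar> \<le> r * r"
    using mult_right_mono[of 1 "\<bar>r\<bar>" "\<bar>r\<bar>"] by (cases "r = 0") (auto simp: abs_mult_self_eq)
  then have "2 * \<bar>r\<bar> \<le> 2 * int (pent r)"
    unfolding two_int_pent by (simp add: algebra_simps)
  then show ?thesis by simp
qed

lemma powi_minus_one: "(-1 :: real) powi r = (-1) ^ nat \<bar>r\<bar>"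
  by (auto simp: power_int_def abs_if)

text \<open>For \<open>\<bar>r\<bar> > n\<close> the argument of \<open>g\<close> is not positive,
  so the infinite sum has finite support and equals the range of \<open>pent_sum n\<close> without
  \<open>r = 0\<close>.\<close>

lemma infsum_pent:
  fixes g :: "int \<Rightarrow> int"
  assumes "\<And>m. m \<le> 0 \<Longrightarrow> g m = 0" and "c \<ge> 1"
  shows "(\<Sum>\<^sub>\<infinity>r\<in>{r. r \<noteq> 0}. (-1) powi r * real_of_int (g (int n - int (c * pent r))))
    = real_of_int (\<Sum>r\<in>{- int n..int n} - {0}. (-1) ^ nat \<bar>r\<bar> * g (int n - int (c * pent r)))"
proof -
  have z: "g (int n - int (c * pent r)) = 0" if "r \<notin> {- int n..int n}" for r
  proof (rule assms)
    have "int (pent r) \<le> int (c * pent r)"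
      unfolding of_nat_le_iff using assms(2) by simp
    moreover have "int n < \<bar>r\<bar>" using that by auto
    ultimately show "int n - int (c * pent r) \<le> 0"
      using abs_le_pent[of r] by linarith
  qed
  have "(\<Sum>\<^sub>\<infinity>r\<in>{r. r \<noteq> 0}. (-1) powi r * real_of_int (g (int n - int (c * pent r))))
    = (\<Sum>\<^sub>\<infinity>r\<in>{- int n..int n} - {0}. (-1) powi r * real_of_int (g (int n - int (c * pent r))))"
    by (rule infsum_cong_neutral) (use z in auto)
  then show ?thesis by (simp add: powi_minus_one)
qed

theorem theorem3p7:
  fixes n :: int
  assumes "n \<ge> 1"
  shows "real_of_int (over_SOME_parts n) =
           real_of_int (SOME_parts n) + real_of_int (DSOME_parts n)
           + (\<Sum>\<^sub>\<infinity>r\<in>{r::int. r \<noteq> 0}.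
                (-1) powi (r + 1) * real_of_int (over_SOME_parts (n - r * (3 * r - 1) div 2)))
           + (\<Sum>\<^sub>\<infinity>r\<in>{r::int. r \<noteq> 0}.
                (-1) powi r * real_of_int (SOME_parts (n - r * (3 * r - 1))))"
proof -
  obtain N where n: "n = int N" using assms nonneg_eq_int by (metis zero_le_one order_trans)
  have neg: "over_SOME_parts m = 0" "SOME_parts m = 0" if "m \<le> 0" for m
    using that by (simp_all add: over_SOME_parts_def SOME_parts_def)
  \<comment> \<open>The factor \<open>1\<close> is the parameter \<open>c\<close>, so that the same
    two lemmas serve \<open>O'\<close> and \<open>S'\<close>.\<close>
  define O' where "O' = (\<Sum>r\<in>{- n..n} - {0}.
    (-1) ^ nat \<bar>r\<bar> * over_SOME_parts (n - int (1 * pent r)))"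
  define S' where "S' = (\<Sum>r\<in>{- n..n} - {0}.
    (-1) ^ nat \<bar>r\<bar> * SOME_parts (n - int (2 * pent r)))"
  \<comment> \<open>Coefficient \<open>N\<close> is the last one controlled by the congruence modulo
    \<open>fps_X ^ Suc N\<close>.\<close>
  have "(over_SOME_fps * pent_sum N (fps_X ^ 1)) $ N
      = (SOME_fps * pent_sum N (fps_X ^ 2)) $ N + DSOME_fps $ N"
    using over_SOME_fps_times_pent_sum[of N]
    by (simp add: fps_X_power_dvd_iff_nth del: power_Suc)
  \<comment> \<open>The term \<open>r = 0\<close> has \<open>pent 0 = 0\<close> and contributes the
    value at \<open>n\<close> itself.\<close>
  moreover have "(over_SOME_fps * pent_sum N (fps_X ^ 1)) $ N = over_SOME_parts n + O'"
    unfolding over_SOME_fps_def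
    by (subst fps_mult_pent_sum_nth)
      (simp_all add: neg n O'_def sum.remove[of _ 0] pent_def)
  moreover have "(SOME_fps * pent_sum N (fps_X ^ 2)) $ N = SOME_parts n + S'"
    unfolding SOME_fps_def
    by (subst fps_mult_pent_sum_nth)
      (simp_all add: neg n S'_def sum.remove[of _ 0] pent_def)
  ultimately have "over_SOME_parts n + O' = SOME_parts n + S' + DSOME_parts n"
    by (simp add: DSOME_fps_def n)
  moreover have "(\<Sum>\<^sub>\<infinity>r\<in>{r::int. r \<noteq> 0}.
      (-1) powi (r + 1) * real_of_int (over_SOME_parts (n - r * (3 * r - 1) div 2)))
      = - real_of_int O'"
  proof -
    \<comment> \<open>The extra 1 in the exponent is the sign acquired when \<open>O'\<close> moves
      to the right-hand side.\<close>
    have "(-1) powi (r + 1) * real_of_int (over_SOME_parts (n - r * (3 * r - 1) div 2))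
        = - ((-1) powi r * real_of_int (over_SOME_parts (int N - int (1 * pent r))))" for r
      by (simp add: int_pent n power_int_add)
    then show ?thesis
      by (simp only: infsum_uminus infsum_pent[of over_SOME_parts 1, OF neg(1) order_refl] O'_def n)
  qed
  moreover have "(\<Sum>\<^sub>\<infinity>r\<in>{r::int. r \<noteq> 0}.
      (-1) powi r * real_of_int (SOME_parts (n - r * (3 * r - 1)))) = real_of_int S'"
    using infsum_pent[of SOME_parts 2 N, OF neg(2)] two_int_pent by (simp add: S'_def n)
  ultimately show ?thesis by linarith
qed

end
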